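(* Let $\beta:\mathbb{Z}\to\mathbb{C}$ be a function for which both limits $\lim_{k\to\pm\infty}(\beta(k)-\beta(k-1))$ exist in $\mathbb{C}$, and let $c\in\mathbb{C}$. Let $D_{\beta,\tau_0}$ be the closure of the operator in $\ell^2(\mathbb{Z})$ given on finite linear combinations of the canonical basis vectors by $D_{\beta,\tau_0}E_n=(\beta(n)+c)E_n$, and let $\tilde D_{\beta,\tau_0}$ be the closure of the operator given on finite linear combinations of basis vectors by $\tilde D_{\beta,\tau_0}E_n=\beta(n)E_{n+1}$. Then $D_{\beta,\tau_0}$ has compact parametrices if and only if $\beta(k)\to\infty$ as $|k|\to\infty$, and likewise $\tilde D_{\beta,\tau_0}$ has compact parametrices if and only if $\beta(k)\to\infty$ as $|k|\to\infty$.
   Context: $\{E_k\}_{k\in\mathbb{Z}}$ is the canonical basis of $\ell^2(\mathbb{Z})$. A closed (densely defined) operator $D$ has compact parametrices if $(1+D^*D)^{-1/2}$ and $(1+DD^* )^{-1/2}$ are compact operators. Since $\beta$ is complex-valued, $\beta(k)\to\infty$ means $|\beta(k)|\to\infty$. *)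

theory Defs
  imports "HOL-Analysis.Analysis"
begin

section \<open>The Hilbert space of square-summable complex families indexed by the integers\<close>

typedef ell2 = "{f :: int \<Rightarrow> complex. (\<lambda>k. (cmod (f k))\<^sup>2) summable_on UNIV}"
  morphisms coord Abs_ell2
  by (rule exI[of _ "\<lambda>_. 0"]) simp

setup_lifting type_definition_ell2

lemma ell2_coord: "(\<lambda>k. (cmod (coord x k))\<^sup>2) summable_on UNIV"
  using coord[of x] by simp

lemma ell2_prod_abs_summable: "(\<lambda>k. cmod (coord x k) * cmod (coord y k)) summable_on UNIV"
proof (rule summable_on_comparison_test)
  show "(\<lambda>k. (cmod (coord x k))\<^sup>2 + (cmod (coord y k))\<^sup>2) summable_on UNIV"
    by (intro summable_on_add ell2_coord)
next
  fix k
  have "2 * (cmod (coord x k) * cmod (coord y k)) \<le> (cmod (coord x k))\<^sup>2 + (cmod (coord y k))\<^sup>2"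
    using sum_squares_bound[of "cmod (coord x k)" "cmod (coord y k)"] by (simp add: mult.assoc)
  moreover have "0 \<le> cmod (coord x k) * cmod (coord y k)" by simp
  ultimately show "cmod (coord x k) * cmod (coord y k) \<le> (cmod (coord x k))\<^sup>2 + (cmod (coord y k))\<^sup>2"
    by linarith
qed simp

lemma ell2_cnj_mult_summable: "(\<lambda>k. cnj (coord x k) * coord y k) summable_on UNIV"
  by (rule abs_summable_summable) (simp add: norm_mult ell2_prod_abs_summable)

lemma ell2_inner_summable: "(\<lambda>k. coord x k \<bullet> coord y k) summable_on UNIV"
proof (rule abs_summable_summable, rule Infinite_Sum.abs_summable_on_comparison_test')
  show "norm (coord x k \<bullet> coord y k) \<le> cmod (coord x k) * cmod (coord y k)" for k
    by (simp add: Cauchy_Schwarz_ineq2)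
qed (rule ell2_prod_abs_summable)

lemma ell2_add_closed:
  assumes "(\<lambda>k. (cmod (f k))\<^sup>2) summable_on (UNIV :: int set)"
    and "(\<lambda>k. (cmod (g k))\<^sup>2) summable_on UNIV"
  shows "(\<lambda>k. (cmod (f k + g k))\<^sup>2) summable_on UNIV"
proof (rule summable_on_comparison_test)
  show "(\<lambda>k. 2 * ((cmod (f k))\<^sup>2 + (cmod (g k))\<^sup>2)) summable_on UNIV"
    by (intro summable_on_cmult_right summable_on_add assms)
next
  fix k
  have "(cmod (f k + g k))\<^sup>2 \<le> (cmod (f k) + cmod (g k))\<^sup>2"
    by (intro power_mono norm_triangle_ineq) simp
  also have "\<dots> \<le> 2 * ((cmod (f k))\<^sup>2 + (cmod (g k))\<^sup>2)"
    using sum_squares_bound[of "cmod (f k)" "cmod (g k)"] by (simp add: power2_sum)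
  finally show "(cmod (f k + g k))\<^sup>2 \<le> 2 * ((cmod (f k))\<^sup>2 + (cmod (g k))\<^sup>2)" .
qed simp

lemma ell2_scale_closed:
  assumes "(\<lambda>k. (cmod (f k))\<^sup>2) summable_on (UNIV :: int set)"
  shows "(\<lambda>k. (cmod (c * f k))\<^sup>2) summable_on UNIV"
  unfolding norm_mult power_mult_distrib by (intro summable_on_cmult_right assms)

lift_definition scaleC :: "complex \<Rightarrow> ell2 \<Rightarrow> ell2"  (infixr \<open>*\<^sub>C\<close> 75)
  is "\<lambda>c f k. c * f k"
  by (rule ell2_scale_closed)

instantiation ell2 :: scaleR
begin

definition scaleR_ell2 :: "real \<Rightarrow> ell2 \<Rightarrow> ell2" where
  "scaleR_ell2 r x = complex_of_real r *\<^sub>C x"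

instance ..

end

instantiation ell2 :: real_inner
begin

lift_definition zero_ell2 :: ell2 is "\<lambda>_. 0"
  by simp

lift_definition plus_ell2 :: "ell2 \<Rightarrow> ell2 \<Rightarrow> ell2" is "\<lambda>f g k. f k + g k"
  by (rule ell2_add_closed)

lift_definition uminus_ell2 :: "ell2 \<Rightarrow> ell2" is "\<lambda>f k. - f k"
  by simp

definition minus_ell2 :: "ell2 \<Rightarrow> ell2 \<Rightarrow> ell2" where
  "x - y = x + (- y)" for x y :: ell2

definition inner_ell2 :: "ell2 \<Rightarrow> ell2 \<Rightarrow> real" where
  "inner_ell2 x y = (\<Sum>\<^sub>\<infinity>k. coord x k \<bullet> coord y k)"

definition norm_ell2 :: "ell2 \<Rightarrow> real" where
  "norm_ell2 x = sqrt (\<Sum>\<^sub>\<infinity>k. (cmod (coord x k))\<^sup>2)"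

definition sgn_ell2 :: "ell2 \<Rightarrow> ell2" where
  "sgn_ell2 x = x /\<^sub>R norm x"

definition dist_ell2 :: "ell2 \<Rightarrow> ell2 \<Rightarrow> real" where
  "dist_ell2 x y = norm (x - y)"

definition uniformity_ell2 :: "(ell2 \<times> ell2) filter" where
  "uniformity_ell2 = (INF e\<in>{0<..}. principal {(x, y). dist x y < e})"

definition open_ell2 :: "ell2 set \<Rightarrow> bool" where
  "open_ell2 U \<longleftrightarrow> (\<forall>x\<in>U. \<forall>\<^sub>F (x', y) in uniformity. x' = x \<longrightarrow> y \<in> U)"

instance
proof
  fix x y z :: ell2 and a b :: real
  show "x + y + z = x + (y + z)" by transfer (simp add: add.assoc)
  show "x + y = y + x" by transfer (simp add: add.commute)
  show "0 + x = x" by transfer simp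
  show "- x + x = 0" by transfer simp
  show "x - y = x + - y" by (simp add: minus_ell2_def)
  show "a *\<^sub>R (x + y) = a *\<^sub>R x + a *\<^sub>R y"
    unfolding scaleR_ell2_def by transfer (simp add: distrib_left)
  show "(a + b) *\<^sub>R x = a *\<^sub>R x + b *\<^sub>R x"
    unfolding scaleR_ell2_def by transfer (simp add: distrib_right)
  show "a *\<^sub>R b *\<^sub>R x = (a * b) *\<^sub>R x"
    unfolding scaleR_ell2_def by transfer (simp add: mult.assoc)
  show "1 *\<^sub>R x = x" unfolding scaleR_ell2_def by transfer simp
  show "sgn x = x /\<^sub>R norm x" by (rule sgn_ell2_def)
  show "dist x y = norm (x - y)" by (rule dist_ell2_def)
  show "uniformity = (INF e\<in>{0<..}. principal {(x :: ell2, y). dist x y < e})"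
    by (rule uniformity_ell2_def)
  show "open U \<longleftrightarrow> (\<forall>x\<in>U. \<forall>\<^sub>F (x', y) in uniformity. x' = x \<longrightarrow> y \<in> U)" for U :: "ell2 set"
    by (rule open_ell2_def)
  show "x \<bullet> y = y \<bullet> x" by (simp add: inner_ell2_def inner_commute)
  show "(x + y) \<bullet> z = x \<bullet> z + y \<bullet> z"
    by (simp add: inner_ell2_def plus_ell2.rep_eq inner_add_left infsum_add ell2_inner_summable)
  have "coord (a *\<^sub>R x) k \<bullet> coord y k = a * (coord x k \<bullet> coord y k)" for k
    by (simp add: scaleR_ell2_def scaleC.rep_eq inner_complex_def algebra_simps)
  then show "a *\<^sub>R x \<bullet> y = a * (x \<bullet> y)"
    by (simp add: inner_ell2_def infsum_cmult_right')
  show "0 \<le> x \<bullet> x" by (simp add: inner_ell2_def infsum_nonneg)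
  show "x \<bullet> x = 0 \<longleftrightarrow> x = 0"
  proof
    assume "x \<bullet> x = 0"
    then have "coord x k \<bullet> coord x k = 0" for k
      unfolding inner_ell2_def
      by (intro nonneg_infsum_le_0D[OF _ ell2_inner_summable]) auto
    then show "x = 0"
      by (simp add: coord_inject[symmetric] zero_ell2.rep_eq fun_eq_iff)
  qed (simp add: inner_ell2_def zero_ell2.rep_eq)
  show "norm x = sqrt (x \<bullet> x)"
    by (simp add: norm_ell2_def inner_ell2_def power2_norm_eq_inner)
qed

end

text \<open>The complex inner product is antilinear in its first argument; its real part is \<open>(\<bullet>)\<close>.\<close>

definition cinner :: "ell2 \<Rightarrow> ell2 \<Rightarrow> complex" where
  "cinner x y = (\<Sum>\<^sub>\<infinity>k. cnj (coord x k) * coord y k)"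

lemma Re_cinner: "Re (cinner x y) = x \<bullet> y"
  by (simp add: cinner_def inner_ell2_def inner_complex_def infsum_Re[symmetric] ell2_cnj_mult_summable)

lift_definition E :: "int \<Rightarrow> ell2" is "\<lambda>n k. if k = n then 1 else 0"
  by (rule finite_nonzero_values_imp_summable_on) simp


section \<open>Unbounded operators\<close>

text \<open>
  A possibly unbounded operator is represented by its graph, so that the closure of an operator
  is the topological closure of its graph in the product space, and an everywhere defined
  operator is one whose graph has domain \<open>UNIV\<close>. In this representation the product of operators
  is relational composition in reversed order: \<open>D O T\<close> is the graph of \<open>x \<mapsto> T (D x)\<close> on its
  maximal domain. The inverse is the converse relation.
\<close>

type_synonym operator = "(ell2 \<times> ell2) set"

definition linear_operator :: "operator \<Rightarrow> bool" where
  "linear_operator T \<longleftrightarrow>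
     single_valued T \<and> (0, 0) \<in> T \<and>
     (\<forall>(x, y)\<in>T. \<forall>(x', y')\<in>T. (x + x', y + y') \<in> T) \<and>
     (\<forall>a. \<forall>(x, y)\<in>T. (a *\<^sub>C x, a *\<^sub>C y) \<in> T)"

definition densely_defined :: "operator \<Rightarrow> bool" where
  "densely_defined T \<longleftrightarrow> closure (Domain T) = UNIV"

text \<open>The relation below is an operator only for densely defined \<open>T\<close>.\<close>

definition adjoint_op :: "operator \<Rightarrow> operator" where
  "adjoint_op T = {(y, z). \<forall>(x, w)\<in>T. cinner w y = cinner x z}"

definition selfadjoint_op :: "operator \<Rightarrow> bool" where
  "selfadjoint_op T \<longleftrightarrow> linear_operator T \<and> densely_defined T \<and> adjoint_op T = T"

definition positive_op :: "operator \<Rightarrow> bool" where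
  "positive_op T \<longleftrightarrow> selfadjoint_op T \<and> (\<forall>(x, y)\<in>T. cinner x y \<in> \<real>\<^sub>\<ge>\<^sub>0)"

definition one_plus :: "operator \<Rightarrow> operator" where
  "one_plus T = {(x, x + y) | x y. (x, y) \<in> T}"

text \<open>A positive self-adjoint operator has exactly one positive self-adjoint square root.\<close>

definition sqrt_op :: "operator \<Rightarrow> operator" where
  "sqrt_op T = (THE S. positive_op S \<and> S O S = T)"

definition compact_op :: "operator \<Rightarrow> bool" where
  "compact_op T \<longleftrightarrow> linear_operator T \<and> Domain T = UNIV \<and> compact (closure (T `` cball 0 1))"

text \<open>
  The square roots are the powers \<open>- 1 / 2\<close> of \<open>1 + D\<^sup>* D\<close> and of \<open>1 + D D\<^sup>*\<close>,
  formed as square roots of the bounded inverses.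
\<close>

definition has_compact_parametrices :: "operator \<Rightarrow> bool" where
  "has_compact_parametrices D \<longleftrightarrow>
     linear_operator D \<and> densely_defined D \<and> closed D \<and>
     compact_op (sqrt_op ((one_plus (D O adjoint_op D))\<inverse>)) \<and>
     compact_op (sqrt_op ((one_plus (adjoint_op D O D))\<inverse>))"

text \<open>
  The linear operator on finite linear combinations of basis vectors that sends \<open>E n\<close> to \<open>v n\<close>.
\<close>

definition basis_operator :: "(int \<Rightarrow> ell2) \<Rightarrow> operator" where
  "basis_operator v = {(\<Sum>n\<in>F. a n *\<^sub>C E n, \<Sum>n\<in>F. a n *\<^sub>C v n) | F a. finite F}"

definition D_op :: "(int \<Rightarrow> complex) \<Rightarrow> complex \<Rightarrow> operator" where
  "D_op \<beta> c = closure (basis_operator (\<lambda>n. (\<beta> n + c) *\<^sub>C E n))"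

definition D_tilde_op :: "(int \<Rightarrow> complex) \<Rightarrow> operator" where
  "D_tilde_op \<beta> = closure (basis_operator (\<lambda>n. \<beta> n *\<^sub>C E (n + 1)))"

end

theory Submission
  imports Defs
begin

text \<open>
  Both operators are weighted shifts \<open>E n \<mapsto> w n *\<^sub>C E (n + s)\<close> on their maximal domain, with adjoint the
  weighted shift by \<open>- s\<close>. Hence \<open>D\<^sup>* D\<close> and \<open>D D\<^sup>*\<close> are diagonal, and the two operators to be
  compact are the diagonal ones with entries \<open>1 / sqrt (1 + |w k|\<^sup>2)\<close> and \<open>1 / sqrt (1 + |w (k - s)|\<^sup>2)\<close>.
  A bounded diagonal operator is compact if and only if its entries tend to zero, which for these
  entries means \<open>|w k| \<rightarrow> \<infinity>\<close>; a constant added to \<open>w\<close> does not affect this.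
\<close>

section \<open>Coordinates\<close>

lemma ell2_eqI: "(\<And>k. coord x k = coord y k) \<Longrightarrow> x = y"
  by (simp add: coord_inject[symmetric] fun_eq_iff)

lemma coord_zero [simp]: "coord 0 k = 0"
  by (simp add: zero_ell2.rep_eq)

lemma coord_add [simp]: "coord (x + y) k = coord x k + coord y k"
  by (simp add: plus_ell2.rep_eq)

lemma coord_uminus [simp]: "coord (- x) k = - coord x k"
  by (simp add: uminus_ell2.rep_eq)

lemma coord_diff [simp]: "coord (x - y) k = coord x k - coord y k"
  unfolding minus_ell2_def by (simp del: add_uminus_conv_diff)

lemma coord_scaleC [simp]: "coord (a *\<^sub>C x) k = a * coord x k"
  by (simp add: scaleC.rep_eq)

lemma coord_scaleR [simp]: "coord (a *\<^sub>R x) k = a *\<^sub>R coord x k"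
  unfolding scaleR_ell2_def coord_scaleC scaleR_conv_of_real ..

lemma coord_E [simp]: "coord (E n) k = (if k = n then 1 else 0)"
  by (simp add: E.rep_eq)

lemma coord_sum [simp]: "coord (sum f A) k = (\<Sum>i\<in>A. coord (f i) k)"
  by (induction A rule: infinite_finite_induct) auto

lemma ex_coord_eq:
  assumes "(\<lambda>k. (cmod (f k))\<^sup>2) summable_on UNIV"
  shows "\<exists>x. \<forall>k. coord x k = f k"
  using Abs_ell2_inverse[of f] assms by (intro exI[of _ "Abs_ell2 f"]) simp

lemma ex_coord_eq_bounded:
  assumes "\<And>k. cmod (f k) \<le> M * cmod (coord x k)"
  shows "\<exists>y. \<forall>k. coord y k = f k"
proof (rule ex_coord_eq, rule summable_on_comparison_test)
  show "(\<lambda>k. M\<^sup>2 * (cmod (coord x k))\<^sup>2) summable_on UNIV"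
    by (intro summable_on_cmult_right ell2_coord)
  show "(cmod (f k))\<^sup>2 \<le> M\<^sup>2 * (cmod (coord x k))\<^sup>2" for k
    using power_mono[OF assms[of k], of 2] by (simp add: power_mult_distrib)
qed simp

section \<open>Norm estimates, basis expansion and pairing with basis vectors\<close>

lemma norm_ell2_sq: "(norm x)\<^sup>2 = (\<Sum>\<^sub>\<infinity>k. (cmod (coord x k))\<^sup>2)"
  by (simp add: norm_ell2_def infsum_nonneg)

lemma sum_coord_le_norm_sq: "finite F \<Longrightarrow> (\<Sum>k\<in>F. (cmod (coord x k))\<^sup>2) \<le> (norm x)\<^sup>2"
  unfolding norm_ell2_sq by (rule finite_sum_le_infsum[OF ell2_coord]) auto

lemma cmod_coord_le: "cmod (coord x k) \<le> norm x"
  using sum_coord_le_norm_sq[of "{k}" x] by (simp add: power2_le_iff_abs_le)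

lemma bounded_linear_coord: "bounded_linear (\<lambda>x. coord x k)"
  by (rule bounded_linear_intro[where K = 1]) (auto simp: cmod_coord_le)

lemmas continuous_on_coord [continuous_intros] =
  bounded_linear.continuous_on[OF bounded_linear_coord]

text \<open>Serves the continuity argument for diagonal operators: finitely many coordinates are
  controlled by those of \<open>y\<close>, and the tail by a small multiple of a vector
  \<open>z\<close> of bounded norm.\<close>

lemma norm_ell2_le_of_split:
  assumes "finite F" "\<And>k. k \<in> F \<Longrightarrow> cmod (coord x k) \<le> cmod (coord y k)"
    and "\<And>k. k \<notin> F \<Longrightarrow> cmod (coord x k) \<le> e * cmod (coord z k)"
  shows "(norm x)\<^sup>2 \<le> (\<Sum>k\<in>F. (cmod (coord y k))\<^sup>2) + (e * norm z)\<^sup>2"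
  unfolding norm_ell2_sq[of x]
proof (rule infsum_le_finite_sums[OF ell2_coord])
  fix G :: "int set" assume G: "finite G"
  have "(\<Sum>k\<in>G. (cmod (coord x k))\<^sup>2) =
      (\<Sum>k\<in>G \<inter> F. (cmod (coord x k))\<^sup>2) + (\<Sum>k\<in>G - F. (cmod (coord x k))\<^sup>2)"
    using G by (rule sum.Int_Diff)
  also have "(\<Sum>k\<in>G \<inter> F. (cmod (coord x k))\<^sup>2) \<le> (\<Sum>k\<in>G \<inter> F. (cmod (coord y k))\<^sup>2)"
    by (intro sum_mono power_mono assms(2)) auto
  also have "\<dots> \<le> (\<Sum>k\<in>F. (cmod (coord y k))\<^sup>2)"
    by (rule sum_mono2) (use assms(1) in auto)
  also have "(\<Sum>k\<in>G - F. (cmod (coord x k))\<^sup>2) \<le> (\<Sum>k\<in>G - F. (e * cmod (coord z k))\<^sup>2)"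
    by (intro sum_mono power_mono assms(3)) auto
  also have "\<dots> = e\<^sup>2 * (\<Sum>k\<in>G - F. (cmod (coord z k))\<^sup>2)"
    by (simp add: power_mult_distrib sum_distrib_left)
  also have "\<dots> \<le> e\<^sup>2 * (norm z)\<^sup>2"
    by (intro mult_left_mono sum_coord_le_norm_sq) (use G in auto)
  finally show "(\<Sum>k\<in>G. (cmod (coord x k))\<^sup>2) \<le> (\<Sum>k\<in>F. (cmod (coord y k))\<^sup>2) + (e * norm z)\<^sup>2"
    by (simp add: power_mult_distrib)
qed

text \<open>The squared distance from \<open>x\<close> to its partial sum over \<open>F\<close> is
  at most the tail \<open>(norm x)^2 - sum q F\<close>, which tends to zero because the squared
  coordinates sum to \<open>(norm x)^2\<close>.\<close>

lemma has_sum_coord_E: "((\<lambda>k. coord x k *\<^sub>C E k) has_sum x) UNIV"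
  unfolding has_sum_def
proof (rule tendstoI)
  fix e :: real assume "e > 0"
  define q where "q k = (cmod (coord x k))\<^sup>2" for k
  have "(q has_sum (norm x)\<^sup>2) UNIV"
    unfolding q_def norm_ell2_sq by (intro has_sum_infsum ell2_coord)
  then have "\<forall>\<^sub>F F in finite_subsets_at_top UNIV. dist (sum q F) ((norm x)\<^sup>2) < e\<^sup>2"
    unfolding has_sum_def by (rule tendstoD) (use \<open>e > 0\<close> in simp)
  moreover have "\<forall>\<^sub>F F in finite_subsets_at_top UNIV. finite (F :: int set)"
    by (rule eventually_finite_subsets_at_top_weakI)
  ultimately show "\<forall>\<^sub>F F in finite_subsets_at_top UNIV. dist (\<Sum>k\<in>F. coord x k *\<^sub>C E k) x < e"
  proof eventually_elim
    fix F :: "int set" assume d: "dist (sum q F) ((norm x)\<^sup>2) < e\<^sup>2" and F: "finite F"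
    define y where "y = (\<Sum>k\<in>F. coord x k *\<^sub>C E k)"
    have y: "coord y k = (if k \<in> F then coord x k else 0)" for k
      using F by (simp add: y_def if_distrib[of "(*) _"] sum.delta cong: if_cong)
    have "(norm (y - x))\<^sup>2 \<le> (norm x)\<^sup>2 - sum q F"
      unfolding norm_ell2_sq[of "y - x"]
    proof (rule infsum_le_finite_sums[OF ell2_coord])
      fix G :: "int set" assume G: "finite G"
      have "(\<Sum>k\<in>G. (cmod (coord (y - x) k))\<^sup>2) = sum q (G - F)"
        unfolding q_def using G by (intro sum.mono_neutral_cong_right) (auto simp: y)
      also have "\<dots> + sum q F = sum q ((G - F) \<union> F)"
        using G F by (subst sum.union_disjoint) auto
      then have "sum q (G - F) = sum q ((G - F) \<union> F) - sum q F" by simp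
      also have "sum q ((G - F) \<union> F) \<le> (norm x)\<^sup>2"
        unfolding q_def by (rule sum_coord_le_norm_sq) (use F G in auto)
      finally show "(\<Sum>k\<in>G. (cmod (coord (y - x) k))\<^sup>2) \<le> (norm x)\<^sup>2 - sum q F" by simp
    qed
    then have "(norm (y - x))\<^sup>2 < e\<^sup>2" using d by (simp add: dist_real_def)
    then show "dist (\<Sum>k\<in>F. coord x k *\<^sub>C E k) x < e"
      using \<open>e > 0\<close> by (simp add: y_def[symmetric] dist_norm power_less_imp_less_base)
  qed
qed

lemma cinner_scaleC_E [simp]: "cinner (a *\<^sub>C E n) y = cnj a * coord y n"
proof -
  have "cinner (a *\<^sub>C E n) y = (\<Sum>\<^sub>\<infinity>k\<in>{n}. cnj (coord (a *\<^sub>C E n) k) * coord y k)"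
    unfolding cinner_def by (rule infsum_cong_neutral) auto
  then show ?thesis by simp
qed

lemma cinner_E [simp]: "cinner (E n) y = coord y n"
proof -
  have "1 *\<^sub>C E n = E n" by (rule ell2_eqI) simp
  then show ?thesis using cinner_scaleC_E[of 1 n y] by (simp del: cinner_scaleC_E)
qed

section \<open>Weighted shifts\<close>

definition weighted_shift :: "(int \<Rightarrow> complex) \<Rightarrow> int \<Rightarrow> operator" where
  "weighted_shift w s = {(x, y). \<forall>k. coord y (k + s) = w k * coord x k}"

lemma weighted_shift_iff: "(x, y) \<in> weighted_shift w s \<longleftrightarrow> (\<forall>k. coord y (k + s) = w k * coord x k)"
  by (simp add: weighted_shift_def)

lemma weighted_shift_E: "(E n, w n *\<^sub>C E (n + s)) \<in> weighted_shift w s"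
  by (simp add: weighted_shift_iff)

lemma linear_weighted_shift: "linear_operator (weighted_shift w s)"
proof -
  have "y = z" if "(x, y) \<in> weighted_shift w s" "(x, z) \<in> weighted_shift w s" for x y z
  proof (rule ell2_eqI)
    show "coord y k = coord z k" for k
      using that[unfolded weighted_shift_iff, THEN spec[of _ "k - s"]] by simp
  qed
  then show ?thesis
    unfolding linear_operator_def single_valued_def
    by (auto simp: weighted_shift_iff algebra_simps)
qed

lemma closed_weighted_shift: "closed (weighted_shift w s)"
proof -
  have "weighted_shift w s = (\<Inter>k. {p. coord (snd p) (k + s) = w k * coord (fst p) k})"
    by (auto simp: weighted_shift_def)
  also have "closed \<dots>"
    by (intro closed_INT ballI closed_Collect_eq continuous_intros)
  finally show ?thesis .
qed

lemma basis_operator_subset: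
  "basis_operator (\<lambda>n. w n *\<^sub>C E (n + s)) \<subseteq> weighted_shift w s"
proof (clarsimp simp: basis_operator_def weighted_shift_iff)
  fix F :: "int set" and a :: "int \<Rightarrow> complex" and k
  assume "finite F"
  then show "(\<Sum>n\<in>F. a n * (w n * (if k = n then 1 else 0))) =
      w k * (\<Sum>n\<in>F. a n * (if k = n then 1 else 0))"
    by (simp add: if_distrib[of "(*) _"] sum.delta cong: if_cong)
qed

text \<open>Identifies the closure with the maximal operator. The nontrivial inclusion truncates the
  basis expansions of \<open>x\<close> and \<open>y\<close> simultaneously, so that the truncated
  pairs lie in the graph of the basis operator.\<close>

lemma closure_basis_operator:
  "closure (basis_operator (\<lambda>n. w n *\<^sub>C E (n + s))) = weighted_shift w s"
proof
  show "closure (basis_operator (\<lambda>n. w n *\<^sub>C E (n + s))) \<subseteq> weighted_shift w s"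
    by (rule closure_minimal[OF basis_operator_subset closed_weighted_shift])
  show "weighted_shift w s \<subseteq> closure (basis_operator (\<lambda>n. w n *\<^sub>C E (n + s)))"
  proof clarify
    fix x y assume xy: "(x, y) \<in> weighted_shift w s"
    \<comment> \<open>Reindexing the expansion of \<open>y\<close> by \<open>k + s\<close> lets both
      expansions run over the same finite sets \<open>F\<close>.\<close>
    have bij: "bij_betw (\<lambda>k. k + s) UNIV UNIV"
      by (rule bij_betwI[where g = "\<lambda>k. k - s"]) auto
    have "((\<lambda>k. coord y (k + s) *\<^sub>C E (k + s)) has_sum y) UNIV"
      using has_sum_reindex_bij_betw[OF bij, of "\<lambda>k. coord y k *\<^sub>C E k" y]
      by (simp add: has_sum_coord_E)
    moreover have "coord y (k + s) *\<^sub>C E (k + s) = coord x k *\<^sub>C w k *\<^sub>C E (k + s)" for k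
      using xy by (intro ell2_eqI) (simp add: weighted_shift_iff)
    ultimately have "((\<lambda>k. coord x k *\<^sub>C w k *\<^sub>C E (k + s)) has_sum y) UNIV"
      by simp
    from tendsto_Pair[OF has_sum_coord_E[of x, unfolded has_sum_def] this[unfolded has_sum_def]]
    show "(x, y) \<in> closure (basis_operator (\<lambda>n. w n *\<^sub>C E (n + s)))"
    proof (rule Lim_in_closed_set[rotated 3])
      show "\<forall>\<^sub>F F in finite_subsets_at_top UNIV. (\<Sum>k\<in>F. coord x k *\<^sub>C E k,
          \<Sum>k\<in>F. coord x k *\<^sub>C w k *\<^sub>C E (k + s)) \<in> closure (basis_operator (\<lambda>n. w n *\<^sub>C E (n + s)))"
        by (rule eventually_finite_subsets_at_top_weakI, rule closure_subset[THEN subsetD])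
          (auto simp: basis_operator_def)
    qed auto
  qed
qed

lemma densely_defined_weighted_shift: "densely_defined (weighted_shift w s)"
proof -
  have "x \<in> closure (Domain (weighted_shift w s))" for x
    using has_sum_coord_E[of x, unfolded has_sum_def]
  proof (rule Lim_in_closed_set[rotated 3])
    have "(\<Sum>k\<in>F. coord x k *\<^sub>C E k) \<in> Domain (weighted_shift w s)" if "finite F" for F
      using that basis_operator_subset[of w s] unfolding basis_operator_def by blast
    then show "\<forall>\<^sub>F F in finite_subsets_at_top UNIV.
        (\<Sum>k\<in>F. coord x k *\<^sub>C E k) \<in> closure (Domain (weighted_shift w s))"
      by (intro eventually_finite_subsets_at_top_weakI closure_subset[THEN subsetD])
  qed auto
  then show ?thesis by (auto simp: densely_defined_def)
qed

text \<open>Testing against the pairs \<open>(E k, w k *\<^sub>C E (k + s))\<close> determines every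
  coordinate of \<open>z\<close>. Conversely, the coordinate equations give the adjoint relation on
  the whole maximal domain after a shift of the summation index.\<close>

lemma adjoint_weighted_shift:
  "adjoint_op (weighted_shift w s) = weighted_shift (\<lambda>k. cnj (w (k - s))) (- s)"
proof -
  have "(y, z) \<in> adjoint_op (weighted_shift w s) \<longleftrightarrow>
      (\<forall>k. coord z k = cnj (w k) * coord y (k + s))" for y z
  proof
    assume "(y, z) \<in> adjoint_op (weighted_shift w s)"
    then have "cinner (w k *\<^sub>C E (k + s)) y = cinner (E k) z" for k
      using weighted_shift_E[of k w s] by (auto simp: adjoint_op_def)
    then show "\<forall>k. coord z k = cnj (w k) * coord y (k + s)" by simp
  next
    assume z: "\<forall>k. coord z k = cnj (w k) * coord y (k + s)"
    have bij: "bij_betw (\<lambda>k. k + s) UNIV UNIV"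
      by (rule bij_betwI[where g = "\<lambda>k. k - s"]) auto
    have "cinner u y = cinner x z" if "(x, u) \<in> weighted_shift w s" for x u
    proof -
      have "cinner u y = (\<Sum>\<^sub>\<infinity>k. cnj (coord u (k + s)) * coord y (k + s))"
        unfolding cinner_def by (rule infsum_reindex_bij_betw[OF bij, symmetric])
      also have "\<dots> = cinner x z"
        unfolding cinner_def using that z
        by (intro infsum_cong) (simp add: weighted_shift_iff)
      finally show ?thesis .
    qed
    then show "(y, z) \<in> adjoint_op (weighted_shift w s)" by (auto simp: adjoint_op_def)
  qed
  moreover have "(\<forall>k. coord z k = cnj (w k) * coord y (k + s)) \<longleftrightarrow>
      (y, z) \<in> weighted_shift (\<lambda>k. cnj (w (k - s))) (- s)" for y z
  proof
    assume *: "(y, z) \<in> weighted_shift (\<lambda>k. cnj (w (k - s))) (- s)"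
    show "\<forall>k. coord z k = cnj (w k) * coord y (k + s)"
      using *[unfolded weighted_shift_iff, THEN spec]
      by (metis add.commute add_diff_cancel_left' diff_conv_add_uminus)
  qed (simp add: weighted_shift_iff)
  ultimately show ?thesis by auto
qed

text \<open>This is \<open>D* D\<close> for the weighted shift \<open>D\<close>. The point is
  equality of domains: if \<open>|w|^2 x\<close> is square-summable along with \<open>x\<close>,
  then so is the intermediate vector with entries \<open>w k * coord x k\<close>.\<close>

lemma weighted_shift_O_adjoint:
  "weighted_shift w s O adjoint_op (weighted_shift w s) =
    weighted_shift (\<lambda>k. of_real ((cmod (w k))\<^sup>2)) 0"
proof -
  have "\<exists>y. (x, y) \<in> weighted_shift w s \<and>
      (y, z) \<in> weighted_shift (\<lambda>k. cnj (w (k - s))) (- s)"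
    if z: "\<And>k. coord z k = of_real ((cmod (w k))\<^sup>2) * coord x k" for x z
  proof -
    have "(\<lambda>k. (cmod (w k * coord x k))\<^sup>2) summable_on UNIV"
    proof (rule summable_on_comparison_test)
      show "(\<lambda>k. (cmod (coord x k))\<^sup>2 + (cmod (coord z k))\<^sup>2) summable_on UNIV"
        by (intro summable_on_add ell2_coord)
      fix k
      \<comment> \<open>With \<open>t = |w k|^2\<close> this is \<open>t \<le> 1 + t^2\<close>,
        which follows from \<open>(t - 1)^2 \<ge> 0\<close> and \<open>t \<ge> 0\<close>.\<close>
      have "(cmod (w k))\<^sup>2 \<le> 1 + ((cmod (w k))\<^sup>2)\<^sup>2"
        using zero_le_power2[of "(cmod (w k))\<^sup>2 - 1"] zero_le_power2[of "cmod (w k)"]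
        unfolding power2_diff by (smt (verit) one_power2)
      then have "(cmod (w k))\<^sup>2 * (cmod (coord x k))\<^sup>2 \<le> (1 + ((cmod (w k))\<^sup>2)\<^sup>2) * (cmod (coord x k))\<^sup>2"
        by (rule mult_right_mono) simp
      then show "(cmod (w k * coord x k))\<^sup>2 \<le> (cmod (coord x k))\<^sup>2 + (cmod (coord z k))\<^sup>2"
        by (simp add: z norm_mult norm_power power_mult_distrib algebra_simps)
    qed simp
    then have "(\<lambda>k. (cmod (w (k - s) * coord x (k - s)))\<^sup>2) summable_on UNIV"
      by (subst summable_on_reindex_bij_witness[where i = "\<lambda>k. k + s" and j = "\<lambda>k. k - s"
            and T = UNIV and h = "\<lambda>k. (cmod (w k * coord x k))\<^sup>2"]) auto
    then obtain y where "\<And>k. coord y k = w (k - s) * coord x (k - s)"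
      using ex_coord_eq[of "\<lambda>k. w (k - s) * coord x (k - s)"] by auto
    moreover have "coord z (k - s) = cnj (w (k - s)) * (w (k - s) * coord x (k - s))" for k
      unfolding z complex_norm_square by (simp only: mult_ac)
    ultimately show ?thesis
      by (intro exI[of _ y]) (simp add: weighted_shift_iff)
  qed
  moreover have "coord z k = of_real ((cmod (w k))\<^sup>2) * coord x k"
    if "(x, y) \<in> weighted_shift w s" "(y, z) \<in> weighted_shift (\<lambda>k. cnj (w (k - s))) (- s)" for x y z k
    using that(1)[unfolded weighted_shift_iff, THEN spec[of _ k]]
      that(2)[unfolded weighted_shift_iff, THEN spec[of _ "k + s"]]
    by (simp add: complex_norm_square del: of_real_power)
  ultimately have "(x, z) \<in> weighted_shift w s O weighted_shift (\<lambda>k. cnj (w (k - s))) (- s) \<longleftrightarrow>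
      (x, z) \<in> weighted_shift (\<lambda>k. of_real ((cmod (w k))\<^sup>2)) 0" for x z
    unfolding relcomp_unfold weighted_shift_iff[of x z] by simp blast
  then show ?thesis
    unfolding adjoint_weighted_shift by auto
qed

text \<open>A weighted shift is the adjoint of its adjoint, so \<open>D D*\<close> is the previous
  product formed for \<open>D*\<close> in place of \<open>D\<close>.\<close>

lemma adjoint_O_weighted_shift:
  "adjoint_op (weighted_shift w s) O weighted_shift w s =
    weighted_shift (\<lambda>k. of_real ((cmod (w (k - s)))\<^sup>2)) 0"
proof -
  have "weighted_shift w s = adjoint_op (weighted_shift (\<lambda>k. cnj (w (k - s))) (- s))"
    by (simp add: adjoint_weighted_shift)
  then show ?thesis
    using weighted_shift_O_adjoint[of "\<lambda>k. cnj (w (k - s))" "- s"]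
    by (simp add: adjoint_weighted_shift)
qed

section \<open>Diagonal operators\<close>

text \<open>Real coefficients make these operators self-adjoint. They may be unbounded, and then the
  domain is the maximal one.\<close>

definition diagonal :: "(int \<Rightarrow> real) \<Rightarrow> operator" where
  "diagonal m = weighted_shift (\<lambda>k. of_real (m k)) 0"

lemma diagonal_iff: "(x, y) \<in> diagonal m \<longleftrightarrow> (\<forall>k. coord y k = of_real (m k) * coord x k)"
  by (simp add: diagonal_def weighted_shift_iff)

lemma Domain_diagonal:
  assumes "\<And>k. \<bar>m k\<bar> \<le> M"
  shows "Domain (diagonal m) = UNIV"
proof -
  have "\<exists>y. (x, y) \<in> diagonal m" for x
    unfolding diagonal_iff
    by (rule ex_coord_eq_bounded[of _ M x]) (simp add: norm_mult assms mult_right_mono)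
  then show ?thesis by auto
qed

lemma selfadjoint_diagonal: "selfadjoint_op (diagonal m)"
  by (simp add: selfadjoint_op_def diagonal_def linear_weighted_shift
      densely_defined_weighted_shift adjoint_weighted_shift)

lemma positive_diagonal:
  assumes "\<And>k. 0 \<le> m k"
  shows "positive_op (diagonal m)"
proof -
  have "cinner x y \<in> \<real>\<^sub>\<ge>\<^sub>0" if "(x, y) \<in> diagonal m" for x y
  proof -
    have "cnj (coord x k) * coord y k = complex_of_real (m k * (cmod (coord x k))\<^sup>2)" for k
      using that by (simp add: diagonal_iff complex_norm_square del: of_real_power)
    then have "Re (cinner x y) = (\<Sum>\<^sub>\<infinity>k. m k * (cmod (coord x k))\<^sup>2)" "Im (cinner x y) = 0"
      using infsum_Re[OF ell2_cnj_mult_summable, of x y] infsum_Im[OF ell2_cnj_mult_summable, of x y]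
      by (simp_all add: cinner_def del: of_real_mult of_real_power)
    then show ?thesis
      using assms by (simp add: complex_nonneg_Reals_iff infsum_nonneg)
  qed
  then show ?thesis by (auto simp: positive_op_def selfadjoint_diagonal)
qed

section \<open>Resolvents and positive square roots of diagonal operators\<close>

lemma converse_one_plus_diagonal:
  assumes "\<And>k. 0 \<le> m k"
  shows "(one_plus (diagonal m))\<inverse> = diagonal (\<lambda>k. 1 / (1 + m k))"
proof -
  have nz: "1 + complex_of_real (m k) \<noteq> 0" for k
    using assms[of k]
    by (metis add_nonneg_eq_0_iff of_real_1 of_real_add of_real_eq_0_iff zero_le_one zero_neq_one)
  have "(u, x) \<in> (one_plus (diagonal m))\<inverse> \<longleftrightarrow> (x, u - x) \<in> diagonal m" for u x
    by (auto simp: one_plus_def intro!: exI[of _ "u - x"])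
  \<comment> \<open>Both graphs are given by coordinatewise equations, so equivalence in each
    coordinate settles the domains as well.\<close>
  moreover have "(x, u - x) \<in> diagonal m \<longleftrightarrow> (u, x) \<in> diagonal (\<lambda>k. 1 / (1 + m k))" for u x
  proof -
    have "b - a = complex_of_real (m k) * a \<longleftrightarrow> a = complex_of_real (1 / (1 + m k)) * b" for a b k
    proof -
      have "b - a = complex_of_real (m k) * a \<longleftrightarrow> b = (1 + complex_of_real (m k)) * a"
        by (simp add: ring_distribs diff_eq_eq add.commute)
      also have "\<dots> \<longleftrightarrow> a = b / (1 + complex_of_real (m k))"
        using nz[of k] by (auto simp: nonzero_eq_divide_eq mult.commute)
      finally show ?thesis by simp
    qed
    then show ?thesis by (simp only: diagonal_iff coord_diff)
  qed
  ultimately show ?thesis by auto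
qed

lemma diagonal_O_diagonal: "diagonal r O diagonal r = diagonal (\<lambda>k. (r k)\<^sup>2)"
  using weighted_shift_O_adjoint[of "\<lambda>k. of_real (r k)" 0]
  by (simp add: diagonal_def adjoint_weighted_shift)

text \<open>Since \<open>sqrt_op\<close> is a definite description, uniqueness of the positive root
  has to be shown. A root \<open>S\<close> agrees with \<open>diagonal r\<close> on basis vectors,
  self-adjointness extends this to \<open>S \<subseteq> diagonal r\<close>, and \<open>S\<close> is
  everywhere defined.\<close>

lemma sqrt_diagonal:
  assumes r: "\<And>k. 0 < r k" "\<And>k. r k \<le> M"
  shows "sqrt_op (diagonal (\<lambda>k. (r k)\<^sup>2)) = diagonal r"
  unfolding sqrt_op_def
proof (rule the_equality)
  show "positive_op (diagonal r) \<and> diagonal r O diagonal r = diagonal (\<lambda>k. (r k)\<^sup>2)"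
    using r(1) by (intro conjI positive_diagonal diagonal_O_diagonal) (simp add: less_imp_le)
next
  fix S assume S: "positive_op S \<and> S O S = diagonal (\<lambda>k. (r k)\<^sup>2)"
  have add: "(x + x', y + y') \<in> S" if "(x, y) \<in> S" "(x', y') \<in> S" for x y x' y'
    using S that unfolding positive_op_def selfadjoint_op_def linear_operator_def by blast
  have scale: "(a *\<^sub>C x, a *\<^sub>C y) \<in> S" if "(x, y) \<in> S" for a x y
    using S that unfolding positive_op_def selfadjoint_op_def linear_operator_def by blast
  have E: "(E n, r n *\<^sub>R E n) \<in> S" for n
  proof -
    have "(E n, (r n)\<^sup>2 *\<^sub>R E n) \<in> S O S"
      using S by (simp add: diagonal_iff scaleR_conv_of_real)
    then obtain y where y: "(E n, y) \<in> S" "(y, (r n)\<^sup>2 *\<^sub>R E n) \<in> S" by auto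
    \<comment> \<open>\<open>S z = - r n z\<close>, so positivity of \<open>S\<close> forces \<open>z = 0\<close>.\<close>
    define z where "z = y - r n *\<^sub>R E n"
    have "(y + of_real (- r n) *\<^sub>C E n, (r n)\<^sup>2 *\<^sub>R E n + of_real (- r n) *\<^sub>C y) \<in> S"
      by (intro add scale y)
    moreover have "y + of_real (- r n) *\<^sub>C E n = z"
      by (rule ell2_eqI) (simp add: z_def scaleR_conv_of_real)
    moreover have "(r n)\<^sup>2 *\<^sub>R E n + of_real (- r n) *\<^sub>C y = (- r n) *\<^sub>R z"
      by (rule ell2_eqI) (simp add: z_def scaleR_conv_of_real power2_eq_square algebra_simps)
    ultimately have "(z, (- r n) *\<^sub>R z) \<in> S" by simp
    then have "cinner z ((- r n) *\<^sub>R z) \<in> \<real>\<^sub>\<ge>\<^sub>0"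
      using S unfolding positive_op_def by blast
    then have "0 \<le> z \<bullet> ((- r n) *\<^sub>R z)"
      by (simp add: complex_nonneg_Reals_iff Re_cinner)
    then have "z \<bullet> z \<le> 0"
      using r(1)[of n] by (simp add: mult_le_0_iff)
    then have "z = 0" using inner_ge_zero[of z] by simp
    then show ?thesis using y(1) by (simp add: z_def)
  qed
  \<comment> \<open>By self-adjointness, pairing \<open>(x, y)\<close> with
    \<open>(E n, r n *\<^sub>R E n)\<close> gives the \<open>n\<close>-th coordinate of
    \<open>y\<close>.\<close>
  have sub: "S \<subseteq> diagonal r"
  proof clarify
    fix x y assume "(x, y) \<in> S"
    then have "(x, y) \<in> adjoint_op S" using S by (simp add: positive_op_def selfadjoint_op_def)
    then have "cinner (r n *\<^sub>R E n) x = cinner (E n) y" for n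
      using E[of n] unfolding adjoint_op_def by blast
    then show "(x, y) \<in> diagonal r" by (simp add: diagonal_iff scaleR_ell2_def)
  qed
  show "S = diagonal r"
  proof (rule antisym[OF sub], clarify)
    fix x y assume xy: "(x, y) \<in> diagonal r"
    \<comment> \<open>The bound makes \<open>S O S\<close> everywhere defined, hence also
      \<open>S\<close>; an everywhere defined operator has no proper single-valued
      extension.\<close>
    have "\<bar>(r k)\<^sup>2\<bar> \<le> M\<^sup>2" for k
      using r[of k] by (simp add: power_mono less_imp_le)
    then have "Domain (S O S) = UNIV" using S Domain_diagonal by metis
    then obtain y' where y': "(x, y') \<in> S" by blast
    then have "(x, y') \<in> diagonal r" using sub by blast
    then have "y' = y" using xy by (intro ell2_eqI) (simp add: diagonal_iff)
    then show "(x, y) \<in> S" using y' by simp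
  qed
qed

section \<open>Compactness criterion for diagonal operators\<close>

lemma norm_le_1_if_partial_sums:
  assumes "\<And>F. finite F \<Longrightarrow> (\<Sum>k\<in>F. (cmod (coord x k))\<^sup>2) \<le> 1"
  shows "norm x \<le> 1"
proof -
  have "(norm x)\<^sup>2 \<le> 1"
    unfolding norm_ell2_sq by (rule infsum_le_finite_sums[OF ell2_coord assms])
  then show ?thesis by (simp add: power2_le_iff_abs_le abs_square_le_1)
qed

text \<open>The unit ball is compact for coordinatewise convergence, by Tychonoff's theorem; a diagonal
  operator with vanishing coefficients is norm continuous on it for that topology.\<close>

lemma compact_diagonal_image:
  assumes bound: "\<And>k. \<bar>r k\<bar> \<le> M" and lim: "(r \<longlongrightarrow> 0) cofinite"
  shows "compact (diagonal r `` cball 0 1)"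
proof -
  \<comment> \<open>The coordinate families of the unit ball. Each condition involves finitely many
    coordinates, so \<open>B\<close> is closed in the product topology.\<close>
  define B where "B = {f :: int \<Rightarrow> complex. \<forall>F. finite F \<longrightarrow> (\<Sum>k\<in>F. (cmod (f k))\<^sup>2) \<le> 1}"
  have coordB: "coord x \<in> B" if "norm x \<le> 1" for x
    using that sum_coord_le_norm_sq[of _ x] power_le_one[of "norm x" 2]
    unfolding B_def by fastforce
  have exB: "\<exists>x. coord x = f \<and> norm x \<le> 1" if "f \<in> B" for f
  proof -
    have "(\<lambda>k. (cmod (f k))\<^sup>2) summable_on UNIV"
      by (rule nonneg_bounded_partial_sums_imp_summable_on[where C = 1])
        (use that in \<open>auto simp: B_def intro!: eventually_finite_subsets_at_top_weakI\<close>)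
    then obtain x where x: "\<And>k. coord x k = f k" using ex_coord_eq[of f] by auto
    then show ?thesis
      using that norm_le_1_if_partial_sums[of x] unfolding B_def by auto
  qed
  have "\<forall>f\<in>B. \<exists>x. coord x = f \<and> norm x \<le> 1" using exB by blast
  then obtain X where X: "\<And>f. f \<in> B \<Longrightarrow> coord (X f) = f \<and> norm (X f) \<le> 1"
    using bchoice[of B] by metis
  have "\<forall>x. \<exists>y. (x, y) \<in> diagonal r" using Domain_diagonal[of r M] bound by blast
  then obtain T where T: "\<And>x. (x, T x) \<in> diagonal r" by metis
  have coordT: "coord (T (X f)) k = of_real (r k) * f k" if "f \<in> B" for f k
    using T[of "X f"] X[OF that] by (simp add: diagonal_iff)

  \<comment> \<open>It remains to show that \<open>B\<close> is compact in the product topology and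
    that \<open>f \<mapsto> T (X f)\<close> is continuous into the norm topology.\<close>
  have image: "diagonal r `` cball 0 1 = (\<lambda>f. T (X f)) ` B"
  proof (intro equalityI subsetI)
    fix y assume "y \<in> diagonal r `` cball 0 1"
    then obtain x where x: "norm x \<le> 1" "(x, y) \<in> diagonal r" by auto
    then have "y = T (X (coord x))"
      using coordB by (intro ell2_eqI) (simp add: coordT diagonal_iff)
    then show "y \<in> (\<lambda>f. T (X f)) ` B" using coordB x(1) by blast
  qed (use X T in \<open>force simp: Image_iff\<close>)

  have "compact (Pi\<^sub>E UNIV (\<lambda>_ :: int. cball (0 :: complex) 1))"
    using compactin_PiE[of "\<lambda>_. euclidean" UNIV "\<lambda>_ :: int. cball (0 :: complex) 1"]
    by (simp add: euclidean_product_topology)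
  moreover have "closed B"
  proof -
    have "B = (\<Inter>F\<in>Collect finite. {f. (\<Sum>k\<in>F. (cmod (f k))\<^sup>2) \<le> 1})"
      by (auto simp: B_def)
    also have "closed \<dots>"
      by (intro closed_INT ballI closed_Collect_le continuous_intros continuous_on_product_coordinates)
    finally show ?thesis .
  qed
  moreover have "B \<subseteq> Pi\<^sub>E UNIV (\<lambda>_. cball 0 1)"
  proof
    fix f assume "f \<in> B"
    then have "cmod (f k) \<le> 1" for k
      unfolding B_def by (auto dest!: spec[of _ "{k}"] simp: abs_square_le_1)
    then show "f \<in> Pi\<^sub>E UNIV (\<lambda>_. cball 0 1)" by auto
  qed
  ultimately have "compact B" by (metis compact_Int_closed inf.absorb_iff2)
  moreover have "continuous_on B (\<lambda>f. T (X f))"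
    unfolding continuous_on_def
  proof (intro ballI tendstoI)
    fix f and e :: real assume f: "f \<in> B" and e: "e > 0"
    \<comment> \<open>Outside \<open>F\<close> the coefficients are below \<open>e / 4\<close> and
      \<open>norm (X g - X f) \<le> 2\<close>, so the tail contributes at most
      \<open>e^2 / 4\<close> to the squared norm. The coordinates in \<open>F\<close> contribute
      less than \<open>e^2 / 2\<close>, for a total below \<open>e^2\<close>.\<close>
    define F where "F = {k. \<not> \<bar>r k\<bar> < e / 4}"
    have "\<forall>\<^sub>F k in cofinite. \<bar>r k\<bar> < e / 4"
      using tendstoD[OF lim, of "e / 4"] e by simp
    then have F: "finite F" by (simp add: F_def eventually_cofinite)
    have "((\<lambda>g. g k) \<longlongrightarrow> f k) (at f within B)" for k
      using continuous_on_subset[OF continuous_on_product_coordinates, of B k] f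
      unfolding continuous_on_def by auto
    then have "((\<lambda>g. \<Sum>k\<in>F. (cmod (of_real M * (g k - f k)))\<^sup>2) \<longlongrightarrow>
        (\<Sum>k\<in>F. (cmod (of_real M * (f k - f k)))\<^sup>2)) (at f within B)"
      by (intro tendsto_intros)
    then have "\<forall>\<^sub>F g in at f within B. (\<Sum>k\<in>F. (cmod (of_real M * (g k - f k)))\<^sup>2) < e\<^sup>2 / 2"
      by (rule order_tendstoD(2)) (use e in simp)
    moreover have "\<forall>\<^sub>F g in at f within B. g \<in> B"
      by (auto simp: eventually_at_filter)
    ultimately show "\<forall>\<^sub>F g in at f within B. dist (T (X g)) (T (X f)) < e"
    proof eventually_elim
      fix g assume small: "(\<Sum>k\<in>F. (cmod (of_real M * (g k - f k)))\<^sup>2) < e\<^sup>2 / 2" and g: "g \<in> B"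
      have diff: "coord (T (X g) - T (X f)) k = of_real (r k) * (g k - f k)" for k
        using f g by (simp add: coordT right_diff_distrib)
      have "(norm (T (X g) - T (X f)))\<^sup>2 \<le>
          (\<Sum>k\<in>F. (cmod (coord (of_real M *\<^sub>C (X g - X f)) k))\<^sup>2) + (e / 4 * norm (X g - X f))\<^sup>2"
      proof (rule norm_ell2_le_of_split[OF F])
        show "cmod (coord (T (X g) - T (X f)) k) \<le> cmod (coord (of_real M *\<^sub>C (X g - X f)) k)" for k
          unfolding diff using bound[of k] X[OF f] X[OF g]
          by (auto simp: norm_mult intro!: mult_right_mono)
        show "cmod (coord (T (X g) - T (X f)) k) \<le> e / 4 * cmod (coord (X g - X f) k)"
          if "k \<notin> F" for k
          using that X[OF f] X[OF g] unfolding diff F_def norm_mult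
          by (intro mult_mono) auto
      qed
      also have "(\<Sum>k\<in>F. (cmod (coord (of_real M *\<^sub>C (X g - X f)) k))\<^sup>2) < e\<^sup>2 / 2"
        using small X[OF f] X[OF g] by simp
      also have "norm (X g - X f) \<le> 2"
        using norm_triangle_ineq4[of "X g" "X f"] X[OF f] X[OF g] by linarith
      then have "(e / 4 * norm (X g - X f))\<^sup>2 \<le> (e / 4 * 2)\<^sup>2"
        using e by (intro power_mono mult_left_mono) auto
      finally have "(norm (T (X g) - T (X f)))\<^sup>2 < e\<^sup>2"
        by (simp add: power_divide) (use e in \<open>smt (verit) zero_le_power2\<close>)
      then show "dist (T (X g)) (T (X f)) < e"
        using e by (simp add: dist_norm power_less_imp_less_base)
    qed
  qed
  ultimately show ?thesis unfolding image by (rule compact_continuous_image[rotated])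
qed

text \<open>If \<open>|r k| \<ge> e\<close> for infinitely many \<open>k\<close>, the images
  \<open>r k *\<^sub>R E k\<close> of these basis vectors are pairwise at distance at least
  \<open>e\<close>, which contradicts total boundedness.\<close>

lemma coefficients_vanish_if_compact:
  assumes "compact (closure (diagonal r `` cball 0 1))"
  shows "(r \<longlongrightarrow> 0) cofinite"
proof (rule tendstoI)
  fix e :: real assume e: "e > 0"
  define A where "A = {k. e \<le> \<bar>r k\<bar>}"
  let ?K = "diagonal r `` cball 0 1"
  have "finite A"
  proof (rule ccontr)
    assume "infinite A"
    \<comment> \<open>Radius \<open>e / 2\<close> ensures that two points in the same ball are less
      than \<open>e\<close> apart; the pigeonhole principle below provides two such points.\<close>
    obtain C where C: "finite C" "closure ?K \<subseteq> (\<Union>c\<in>C. ball c (e / 2))"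
      using assms e unfolding compact_eq_totally_bounded by (metis half_gt_zero)
    have norm_E: "norm (E k) \<le> 1" for k
      by (rule norm_le_1_if_partial_sums) (simp add: if_distrib[of cmod] if_distrib[of "\<lambda>x. x\<^sup>2"] cong: if_cong)
    have "r k *\<^sub>R E k \<in> ?K" for k
      using norm_E[of k] by (intro ImageI[of "E k"]) (auto simp: diagonal_iff scaleR_conv_of_real)
    then have "\<forall>k\<in>A. \<exists>c\<in>C. dist c (r k *\<^sub>R E k) < e / 2"
      using C(2) closure_subset[of ?K] by (fastforce simp: subset_iff)
    from pigeonhole_infinite_rel[OF \<open>infinite A\<close> C(1) this]
    obtain c where c: "infinite {k \<in> A. dist c (r k *\<^sub>R E k) < e / 2}" by blast
    then obtain k where k: "k \<in> A" "dist c (r k *\<^sub>R E k) < e / 2"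
      using not_finite_existsD by auto
    obtain l where l: "dist c (r l *\<^sub>R E l) < e / 2" "l \<noteq> k"
      using infinite_imp_nonempty[OF infinite_remove[OF c, of k]] by blast
    have "e \<le> \<bar>r k\<bar>" using k(1) by (simp add: A_def)
    also have "\<dots> = cmod (coord (r k *\<^sub>R E k - r l *\<^sub>R E l) k)" using l(2) by simp
    also have "\<dots> \<le> dist (r k *\<^sub>R E k) (r l *\<^sub>R E l)"
      unfolding dist_norm by (rule cmod_coord_le)
    also have "\<dots> < e"
      using dist_triangle2[of "r k *\<^sub>R E k" "r l *\<^sub>R E l" c] k(2) l(1)
      by (simp add: dist_commute)
    finally show False by simp
  qed
  then show "\<forall>\<^sub>F k in cofinite. dist (r k) 0 < e"
    by (simp add: eventually_cofinite A_def not_less)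
qed

lemma compact_diagonal_iff:
  assumes "\<And>k. \<bar>r k\<bar> \<le> M"
  shows "compact_op (diagonal r) \<longleftrightarrow> (r \<longlongrightarrow> 0) cofinite"
proof
  assume "(r \<longlongrightarrow> 0) cofinite"
  from compact_diagonal_image[OF assms this]
  show "compact_op (diagonal r)"
    using Domain_diagonal[OF assms] linear_weighted_shift
    by (simp add: compact_op_def closure_closed compact_imp_closed diagonal_def)
qed (auto simp: compact_op_def intro: coefficients_vanish_if_compact)

section \<open>Compact parametrices\<close>

text \<open>The function \<open>t \<mapsto> 1 / sqrt (1 + t^2)\<close> is strictly decreasing for
  \<open>t \<ge> 0\<close> and tends to zero at infinity.\<close>

lemma inverse_sqrt_tendsto_0_iff:
  fixes v :: "'a \<Rightarrow> 'b :: real_normed_vector"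
  shows "((\<lambda>k. 1 / sqrt (1 + (norm (v k))\<^sup>2)) \<longlongrightarrow> 0) F \<longleftrightarrow> filterlim v at_infinity F"
proof
  assume lim: "((\<lambda>k. 1 / sqrt (1 + (norm (v k))\<^sup>2)) \<longlongrightarrow> 0) F"
  show "filterlim v at_infinity F"
    unfolding filterlim_at_infinity[OF order_refl]
  proof (intro allI impI)
    fix C :: real assume C: "0 < C"
    have pos: "0 < 1 + C\<^sup>2" "0 < 1 + (norm (v k))\<^sup>2" for k
      by (simp_all add: add_pos_nonneg)
    have "\<forall>\<^sub>F k in F. 1 / sqrt (1 + (norm (v k))\<^sup>2) < 1 / sqrt (1 + C\<^sup>2)"
      by (rule order_tendstoD(2)[OF lim]) (use pos in simp)
    then show "\<forall>\<^sub>F k in F. C \<le> norm (v k)"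
    proof eventually_elim
      case (elim k)
      then have "C\<^sup>2 < (norm (v k))\<^sup>2"
        using pos(1) pos(2)[of k] by (simp add: field_simps)
      then show ?case using power_less_imp_less_base[of C 2 "norm (v k)"] by simp
    qed
  qed
next
  assume lim: "filterlim v at_infinity F"
  show "((\<lambda>k. 1 / sqrt (1 + (norm (v k))\<^sup>2)) \<longlongrightarrow> 0) F"
  proof (rule tendstoI)
    fix e :: real assume e: "e > 0"
    \<comment> \<open>The threshold \<open>1 / e\<close> suffices because
      \<open>norm (v k) < sqrt (1 + (norm (v k))^2)\<close>.\<close>
    have "\<forall>\<^sub>F k in F. 1 / e \<le> norm (v k)"
      using lim e unfolding filterlim_at_infinity[OF order_refl] by simp
    then show "\<forall>\<^sub>F k in F. dist (1 / sqrt (1 + (norm (v k))\<^sup>2)) 0 < e"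
    proof eventually_elim
      case (elim k)
      have "norm (v k) < sqrt (1 + (norm (v k))\<^sup>2)" by (rule real_less_rsqrt) simp
      with elim have "1 / e < sqrt (1 + (norm (v k))\<^sup>2)" by linarith
      moreover have "0 < sqrt (1 + (norm (v k))\<^sup>2)" by (simp add: add_pos_nonneg)
      ultimately show ?case using e by (simp add: field_simps)
    qed
  qed
qed

text \<open>The resolvent is diagonal with entries \<open>(r k)^2\<close>, where
  \<open>0 < r k \<le> 1\<close>, so its square root is \<open>diagonal r\<close>. Taking
  \<open>v\<close> to be \<open>w\<close> or its translate covers both parametrices.\<close>

lemma compact_sqrt_resolvent_iff:
  "compact_op (sqrt_op ((one_plus (weighted_shift (\<lambda>k. of_real ((cmod (v k))\<^sup>2)) 0))\<inverse>)) \<longleftrightarrow>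
    filterlim v at_infinity cofinite"
proof -
  define r where "r k = 1 / sqrt (1 + (cmod (v k))\<^sup>2)" for k
  have "1 \<le> sqrt (1 + (cmod (v k))\<^sup>2)" for k by simp
  then have r: "0 < r k" "r k \<le> 1" for k
    unfolding r_def by (simp_all add: add_pos_nonneg)
  have "(one_plus (weighted_shift (\<lambda>k. of_real ((cmod (v k))\<^sup>2)) 0))\<inverse> = diagonal (\<lambda>k. (r k)\<^sup>2)"
    using converse_one_plus_diagonal[of "\<lambda>k. (cmod (v k))\<^sup>2"]
    unfolding diagonal_def[of "\<lambda>k. (cmod (v k))\<^sup>2"] by (simp add: r_def power_divide)
  then have "sqrt_op ((one_plus (weighted_shift (\<lambda>k. of_real ((cmod (v k))\<^sup>2)) 0))\<inverse>) = diagonal r"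
    using sqrt_diagonal[OF r] by simp
  moreover have "compact_op (diagonal r) \<longleftrightarrow> (r \<longlongrightarrow> 0) cofinite"
    using r by (intro compact_diagonal_iff[of r 1]) (simp add: less_imp_le)
  ultimately show ?thesis
    by (simp add: r_def[abs_def] inverse_sqrt_tendsto_0_iff)
qed

text \<open>Compactness for \<open>D* D\<close> is the condition on \<open>w\<close> itself.
  Compactness for \<open>D D*\<close> is the condition on the translate of \<open>w\<close> by
  \<open>s\<close>, which follows because translation preserves cofinite sets.\<close>

lemma has_compact_parametrices_weighted_shift:
  "has_compact_parametrices (weighted_shift w s) \<longleftrightarrow> filterlim w at_infinity cofinite"
proof -
  have "filterlim (\<lambda>k. k - s) cofinite cofinite"
    unfolding filterlim_iff eventually_cofinite
  proof (intro allI impI)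
    fix P :: "int \<Rightarrow> bool" assume "finite {k. \<not> P k}"
    then have "finite ((\<lambda>k. k - s) -` {k. \<not> P k})"
      by (rule finite_vimageI) (simp add: inj_on_def)
    then show "finite {k. \<not> P (k - s)}" by (simp add: vimage_def)
  qed
  then have "filterlim (\<lambda>k. w (k - s)) at_infinity cofinite" if "filterlim w at_infinity cofinite"
    using filterlim_compose[OF that] by blast
  then show ?thesis
    unfolding has_compact_parametrices_def weighted_shift_O_adjoint adjoint_O_weighted_shift
      compact_sqrt_resolvent_iff
    using linear_weighted_shift densely_defined_weighted_shift closed_weighted_shift by blast
qed

text \<open>A set of integers is finite exactly when it is bounded in absolute value. This turns the
  cofinite criterion into the limit \<open>|k| \<rightarrow> \<infinity>\<close>.\<close>

lemma filtercomap_abs_at_top: "filtercomap (\<lambda>k :: int. \<bar>k\<bar>) at_top = cofinite"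
proof (rule filter_eqI)
  fix P :: "int \<Rightarrow> bool"
  show "eventually P (filtercomap (\<lambda>k. \<bar>k\<bar>) at_top) \<longleftrightarrow> eventually P cofinite"
    unfolding eventually_filtercomap_at_top_linorder eventually_cofinite
  proof
    assume "\<exists>N. \<forall>k. N \<le> \<bar>k\<bar> \<longrightarrow> P k"
    then obtain N where N: "\<And>k. N \<le> \<bar>k\<bar> \<Longrightarrow> P k" by blast
    have "{k. \<not> P k} \<subseteq> {- N..N}"
    proof
      fix k assume "k \<in> {k. \<not> P k}"
      then have "\<not> N \<le> \<bar>k\<bar>" using N by blast
      then show "k \<in> {- N..N}" by auto
    qed
    then show "finite {k. \<not> P k}" by (rule finite_subset) simp
  next
    assume "finite {k. \<not> P k}"
    then obtain N where N: "\<And>k. \<not> P k \<Longrightarrow> \<bar>k\<bar> \<le> N"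
      using bdd_above_finite[of "abs ` {k. \<not> P k}"] by (auto simp: bdd_above_def)
    then show "\<exists>N. \<forall>k. N \<le> \<bar>k\<bar> \<longrightarrow> P k"
      \<comment> \<open>Exceptions to \<open>P\<close> may occur up to and including
        \<open>|k| = N\<close>.\<close>
      by (intro exI[of _ "N + 1"]) (meson not_less zless_add1_eq add1_zle_eq)
  qed
qed

text \<open>Adding a convergent function preserves divergence to infinity; the converse adds
  \<open>- c\<close> back.\<close>

lemma filterlim_add_const_at_infinity_iff:
  fixes f :: "'a \<Rightarrow> 'b :: real_normed_vector"
  shows "filterlim (\<lambda>x. f x + c) at_infinity F \<longleftrightarrow> filterlim f at_infinity F"
  using tendsto_add_filterlim_at_infinity'[of f F "\<lambda>_. c" c]
    tendsto_add_filterlim_at_infinity'[of "\<lambda>x. f x + c" F "\<lambda>_. - c" "- c"]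
  by auto

theorem proposition6p1:
  fixes \<beta> :: "int \<Rightarrow> complex" and c :: complex
  assumes "\<exists>L. ((\<lambda>k. \<beta> k - \<beta> (k - 1)) \<longlongrightarrow> L) at_top"
    and "\<exists>L. ((\<lambda>k. \<beta> k - \<beta> (k - 1)) \<longlongrightarrow> L) at_bot"
  shows "(has_compact_parametrices (D_op \<beta> c) \<longleftrightarrow>
           filterlim \<beta> at_infinity (filtercomap (\<lambda>k. \<bar>k\<bar>) at_top)) \<and>
         (has_compact_parametrices (D_tilde_op \<beta>) \<longleftrightarrow>
           filterlim \<beta> at_infinity (filtercomap (\<lambda>k. \<bar>k\<bar>) at_top))"
proof -
  have "D_op \<beta> c = weighted_shift (\<lambda>n. \<beta> n + c) 0"
    using closure_basis_operator[of "\<lambda>n. \<beta> n + c" 0] by (simp add: D_op_def)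
  moreover have "D_tilde_op \<beta> = weighted_shift \<beta> 1"
    unfolding D_tilde_op_def by (rule closure_basis_operator)
  ultimately show ?thesis
    by (simp add: has_compact_parametrices_weighted_shift filtercomap_abs_at_top
        filterlim_add_const_at_infinity_iff)
qed

end
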